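(* Let $R_1,R_2$ be commutative rings with non-zero identity, let $M_1$ be an $R_1$-module and $M_2$ an $R_2$-module, and let $R=R_1\times R_2$ and $M=M_1\times M_2$. Suppose that $N_1$ is a proper submodule of $M_1$. If $N=N_1\times M_2$ is a 1-absorbing primary submodule of the $R$-module $M$, then $N_1$ is a 1-absorbing primary submodule of the $R_1$-module $M_1$.
   Context: All rings are commutative with non-zero identity and all modules are unitary. $M_1\times M_2$ is an $R_1\times R_2$-module with componentwise operations. For a submodule $N$ of an $R$-module $M$, $(N:_R M)=\{r\in R: rM\subseteq N\}$. A proper submodule $P$ of $M$ is prime if for $a\in R$, $m\in M$, $am\in P$ implies $m\in P$ or $a\in (P:_R M)$. $M\text{-}\mathrm{rad}(N)$ is the intersection of all prime submodules of $M$ containing $N$, and $M\text{-}\mathrm{rad}(N)=M$ if there is no such prime submodule. A proper submodule $N$ of an $R$-module $M$ is a 1-absorbing primary submodule if whenever $a,b\in R$ are non-unit elements and $m\in M$ with $abm\in N$, then $ab\in (N:_R M)$ or $m\in M\text{-}\mathrm{rad}(N)$. *)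

theory Defs
  imports "HOL-Algebra.Module" "HOL-Algebra.Chinese_Remainder"
begin

text \<open>The scalar product acts componentwise. The \<open>mult\<close> and \<open>one\<close> fields of the module record
  carry no meaning for modules; here they are simply inherited from \<^const>\<open>RDirProd\<close>.\<close>

definition MDirProd ::
  "('a, 'b, 'm) module_scheme \<Rightarrow> ('c, 'd, 'n) module_scheme \<Rightarrow> ('a \<times> 'c, 'b \<times> 'd) module"
  where "MDirProd M1 M2 = ring.extend (RDirProd M1 M2)
    (module.fields (\<lambda>(a, b) (x, y). (a \<odot>\<^bsub>M1\<^esub> x, b \<odot>\<^bsub>M2\<^esub> y)))"

definition colon ::
  "('a, 'r) ring_scheme \<Rightarrow> ('a, 'b, 'm) module_scheme \<Rightarrow> 'b set \<Rightarrow> 'a set"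
  where "colon R M N = {r \<in> carrier R. \<forall>x \<in> carrier M. r \<odot>\<^bsub>M\<^esub> x \<in> N}"

definition proper_submodule ::
  "('a, 'r) ring_scheme \<Rightarrow> ('a, 'b, 'm) module_scheme \<Rightarrow> 'b set \<Rightarrow> bool"
  where "proper_submodule R M N \<longleftrightarrow> submodule N R M \<and> N \<noteq> carrier M"

definition prime_submodule ::
  "('a, 'r) ring_scheme \<Rightarrow> ('a, 'b, 'm) module_scheme \<Rightarrow> 'b set \<Rightarrow> bool"
  where "prime_submodule R M P \<longleftrightarrow> proper_submodule R M P \<and>
    (\<forall>a \<in> carrier R. \<forall>x \<in> carrier M. a \<odot>\<^bsub>M\<^esub> x \<in> P \<longrightarrow> x \<in> P \<or> a \<in> colon R M P)"

text \<open>The empty intersection has to be treated separately: \<open>\<Inter>{}\<close> is the whole type,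
  not \<open>carrier M\<close>.\<close>

definition module_rad ::
  "('a, 'r) ring_scheme \<Rightarrow> ('a, 'b, 'm) module_scheme \<Rightarrow> 'b set \<Rightarrow> 'b set"
  where "module_rad R M N =
    (if \<exists>P. prime_submodule R M P \<and> N \<subseteq> P
     then \<Inter>{P. prime_submodule R M P \<and> N \<subseteq> P}
     else carrier M)"

definition one_absorbing_primary_submodule ::
  "('a, 'r) ring_scheme \<Rightarrow> ('a, 'b, 'm) module_scheme \<Rightarrow> 'b set \<Rightarrow> bool"
  where "one_absorbing_primary_submodule R M N \<longleftrightarrow> proper_submodule R M N \<and>
    (\<forall>a \<in> carrier R - Units R. \<forall>b \<in> carrier R - Units R. \<forall>x \<in> carrier M.
       (a \<otimes>\<^bsub>R\<^esub> b) \<odot>\<^bsub>M\<^esub> x \<in> N \<longrightarrow> a \<otimes>\<^bsub>R\<^esub> b \<in> colon R M N \<or> x \<in> module_rad R M N)"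

lemma MDirProd_simps:
  "carrier (MDirProd M1 M2) = carrier M1 \<times> carrier M2"
  "\<zero>\<^bsub>MDirProd M1 M2\<^esub> = (\<zero>\<^bsub>M1\<^esub>, \<zero>\<^bsub>M2\<^esub>)"
  "(x, y) \<oplus>\<^bsub>MDirProd M1 M2\<^esub> (x', y') = (x \<oplus>\<^bsub>M1\<^esub> x', y \<oplus>\<^bsub>M2\<^esub> y')"
  "(a, b) \<odot>\<^bsub>MDirProd M1 M2\<^esub> (x, y) = (a \<odot>\<^bsub>M1\<^esub> x, b \<odot>\<^bsub>M2\<^esub> y)"
  by (simp_all add: MDirProd_def RDirProd_def DirProd_def monoid.defs ring.defs module.defs)

lemma RDirProd_simps:
  "\<one>\<^bsub>RDirProd R S\<^esub> = (\<one>\<^bsub>R\<^esub>, \<one>\<^bsub>S\<^esub>)"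
  "\<zero>\<^bsub>RDirProd R S\<^esub> = (\<zero>\<^bsub>R\<^esub>, \<zero>\<^bsub>S\<^esub>)"
  "(x, y) \<oplus>\<^bsub>RDirProd R S\<^esub> (x', y') = (x \<oplus>\<^bsub>R\<^esub> x', y \<oplus>\<^bsub>S\<^esub> y')"
  "(x, y) \<otimes>\<^bsub>RDirProd R S\<^esub> (x', y') = (x \<otimes>\<^bsub>R\<^esub> x', y \<otimes>\<^bsub>S\<^esub> y')"
  by (simp_all add: RDirProd_def DirProd_def monoid.defs)

lemma MDirProd_module:
  assumes "module R1 M1" and "module R2 M2"
  shows "module (RDirProd R1 R2) (MDirProd M1 M2)"
proof -
  interpret A: module R1 M1 by fact
  interpret B: module R2 M2 by fact
  show ?thesis
  proof (rule moduleI)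
    interpret P: ring "RDirProd R1 R2"
      by (rule RDirProd_ring[OF A.R.ring_axioms B.R.ring_axioms])
    show "cring (RDirProd R1 R2)"
      by unfold_locales (auto simp: RDirProd_carrier RDirProd_simps A.R.m_comm B.R.m_comm)
    show "abelian_group (MDirProd M1 M2)"
    proof (rule abelian_groupI)
      fix x assume "x \<in> carrier (MDirProd M1 M2)"
      then show "\<exists>y\<in>carrier (MDirProd M1 M2). y \<oplus>\<^bsub>MDirProd M1 M2\<^esub> x = \<zero>\<^bsub>MDirProd M1 M2\<^esub>"
        by (intro bexI[of _ "(\<ominus>\<^bsub>M1\<^esub> fst x, \<ominus>\<^bsub>M2\<^esub> snd x)"])
           (auto simp: MDirProd_simps A.M.l_neg B.M.l_neg)
    qed (auto simp: MDirProd_simps A.M.a_assoc B.M.a_assoc intro: A.M.a_comm B.M.a_comm)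
  qed (auto simp: MDirProd_simps RDirProd_carrier RDirProd_simps
      A.smult_l_distr B.smult_l_distr A.smult_r_distr B.smult_r_distr
      A.smult_assoc1 B.smult_assoc1)
qed

end

theory Submission
  imports Defs
begin

text \<open>Non-units \<open>a, b\<close> of \<open>R1\<close> lift to the non-units \<open>(a, \<one>)\<close> and \<open>(b, \<one>)\<close> of the product
  ring, and \<open>x\<close> lifts to \<open>(x, \<zero>)\<close>. The second components impose no condition, because the second
  factor of \<open>N1 \<times> carrier M2\<close> is everything, so the 1-absorbing primary property of the product
  says that \<open>a \<otimes> b\<close> carries \<open>M1\<close> into \<open>N1\<close> or that \<open>(x, \<zero>)\<close> lies in the radical of
  \<open>N1 \<times> carrier M2\<close>.

  What remains is to compare radicals. If \<open>P\<close> is a prime submodule of \<open>M1\<close> containing \<open>N1\<close>, then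
  \<open>P \<times> carrier M2\<close> is a prime submodule of the product containing \<open>N1 \<times> carrier M2\<close>
  (\<open>prime_submodule_Times\<close>). So an element of the radical of the product has its first component
  in every such \<open>P\<close>, hence in the radical of \<open>N1\<close> (\<open>fst_in_module_rad\<close>); if there is no such \<open>P\<close>,
  that radical is all of \<open>M1\<close>.\<close>

lemma submodule_Times_carrier:
  assumes "module R1 M1" and "module R2 M2" and "submodule P R1 M1"
  shows "submodule (P \<times> carrier M2) (RDirProd R1 R2) (MDirProd M1 M2)"
proof -
  interpret M1: module R1 M1 by fact
  interpret M2: module R2 M2 by fact
  interpret M: module "RDirProd R1 R2" "MDirProd M1 M2"
    using assms(1,2) by (rule MDirProd_module)
  note P = M1.submoduleE[OF assms(3)]
  show ?thesis
  proof (rule M.submoduleI)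
    show "P \<times> carrier M2 \<subseteq> carrier (MDirProd M1 M2)"
      using P(1) by (auto simp: MDirProd_simps)
    show "\<zero>\<^bsub>MDirProd M1 M2\<^esub> \<in> P \<times> carrier M2"
      using subgroup.one_closed[OF submodule.axioms(1)[OF assms(3)]]
      by (simp add: MDirProd_simps)
  next
    fix z assume "z \<in> P \<times> carrier M2"
    then obtain x y where z: "z = (x, y)" and x: "x \<in> P" "x \<in> carrier M1" and y: "y \<in> carrier M2"
      using P(1) by auto
    have "\<ominus>\<^bsub>MDirProd M1 M2\<^esub> (x, y) = (\<ominus>\<^bsub>M1\<^esub> x, \<ominus>\<^bsub>M2\<^esub> y)"
      by (rule M.minus_equality) (use x y in \<open>simp_all add: MDirProd_simps M1.M.l_neg M2.M.l_neg\<close>)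
    then show "\<ominus>\<^bsub>MDirProd M1 M2\<^esub> z \<in> P \<times> carrier M2"
      using z x y P(3) by simp
  qed (use P in \<open>auto simp: MDirProd_simps RDirProd_carrier\<close>)
qed

lemma colon_Times_carrier:
  assumes "module R2 M2"
  shows "colon (RDirProd R1 R2) (MDirProd M1 M2) (P \<times> carrier M2) = colon R1 M1 P \<times> carrier R2"
proof -
  interpret M2: module R2 M2 by fact
  have "carrier M2 \<noteq> {}" using M2.zero_closed by blast
  then show ?thesis
    by (auto simp: colon_def RDirProd_carrier MDirProd_simps)
qed

lemma Units_RDirProd: "Units (RDirProd R1 R2) = Units R1 \<times> Units R2"
  unfolding Units_def RDirProd_carrier
  by (auto simp: RDirProd_simps; blast)

text \<open>Both membership in \<open>P \<times> carrier M2\<close> and membership in its colon ideal depend on the first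
  component alone, so the primeness condition for the product is the one for \<open>P\<close>. Properness
  survives because \<open>carrier M2\<close> is non-empty, even when \<open>M2\<close> is the zero module.\<close>

lemma prime_submodule_Times:
  assumes "module R1 M1" and "module R2 M2" and "prime_submodule R1 M1 P"
  shows "prime_submodule (RDirProd R1 R2) (MDirProd M1 M2) (P \<times> carrier M2)"
proof -
  interpret M2: module R2 M2 by fact
  have "\<zero>\<^bsub>M2\<^esub> \<in> carrier M2" by simp
  then have "P \<times> carrier M2 \<noteq> carrier M1 \<times> carrier M2"
    using assms(3) by (auto simp: prime_submodule_def proper_submodule_def)
  then show ?thesis
    using assms by (auto simp: prime_submodule_def proper_submodule_def submodule_Times_carrier
        colon_Times_carrier MDirProd_simps RDirProd_carrier)
qed

text \<open>Intersecting just the primes \<open>P \<times> carrier M2\<close>, one for each prime \<open>P\<close> above \<open>N\<close>, already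
  bounds the radical of the product tightly enough in the first component.\<close>

lemma fst_in_module_rad:
  assumes "module R1 M1" and "module R2 M2" and "x \<in> carrier M1"
    and "(x, y) \<in> module_rad (RDirProd R1 R2) (MDirProd M1 M2) (N \<times> carrier M2)"
  shows "x \<in> module_rad R1 M1 N"
proof (cases "\<exists>P. prime_submodule R1 M1 P \<and> N \<subseteq> P")
  case True
  have "x \<in> P" if "prime_submodule R1 M1 P" and "N \<subseteq> P" for P
  proof -
    have "prime_submodule (RDirProd R1 R2) (MDirProd M1 M2) (P \<times> carrier M2)"
      using assms(1,2) that(1) by (rule prime_submodule_Times)
    moreover have "N \<times> carrier M2 \<subseteq> P \<times> carrier M2" using that(2) by auto
    ultimately have "(x, y) \<in> P \<times> carrier M2"
      using assms(4) unfolding module_rad_def by (auto split: if_splits)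
    then show ?thesis by simp
  qed
  with True show ?thesis by (auto simp: module_rad_def)
next
  case False
  with assms(3) show ?thesis by (auto simp: module_rad_def)
qed

theorem proposition4:
  fixes R1 :: "('r1, 'p1) ring_scheme" and R2 :: "('r2, 'p2) ring_scheme"
    and M1 :: "('r1, 'm1, 'q1) module_scheme" and M2 :: "('r2, 'm2, 'q2) module_scheme"
    and N1 :: "'m1 set"
  assumes "cring R1" and "\<one>\<^bsub>R1\<^esub> \<noteq> \<zero>\<^bsub>R1\<^esub>"
    and "cring R2" and "\<one>\<^bsub>R2\<^esub> \<noteq> \<zero>\<^bsub>R2\<^esub>"
    and "module R1 M1" and "module R2 M2"
    and "proper_submodule R1 M1 N1"
    and "one_absorbing_primary_submodule (RDirProd R1 R2) (MDirProd M1 M2) (N1 \<times> carrier M2)"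
  shows "one_absorbing_primary_submodule R1 M1 N1"
proof -
  interpret R2: cring R2 by fact
  interpret M2: module R2 M2 by fact
  have "a \<otimes>\<^bsub>R1\<^esub> b \<in> colon R1 M1 N1 \<or> x \<in> module_rad R1 M1 N1"
    if a: "a \<in> carrier R1 - Units R1" and b: "b \<in> carrier R1 - Units R1"
      and x: "x \<in> carrier M1" and abx: "(a \<otimes>\<^bsub>R1\<^esub> b) \<odot>\<^bsub>M1\<^esub> x \<in> N1" for a b x
  proof -
    let ?R = "RDirProd R1 R2" and ?M = "MDirProd M1 M2" and ?N = "N1 \<times> carrier M2"
    let ?a = "(a, \<one>\<^bsub>R2\<^esub>)" and ?b = "(b, \<one>\<^bsub>R2\<^esub>)" and ?x = "(x, \<zero>\<^bsub>M2\<^esub>)"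
    have "?a \<in> carrier ?R - Units ?R" and "?b \<in> carrier ?R - Units ?R" and "?x \<in> carrier ?M"
      using a b x by (auto simp: Units_RDirProd RDirProd_carrier MDirProd_simps)
    moreover have "(?a \<otimes>\<^bsub>?R\<^esub> ?b) \<odot>\<^bsub>?M\<^esub> ?x \<in> ?N"
      using abx by (simp add: RDirProd_simps MDirProd_simps)
    ultimately have "?a \<otimes>\<^bsub>?R\<^esub> ?b \<in> colon ?R ?M ?N \<or> ?x \<in> module_rad ?R ?M ?N"
      using assms(8)[unfolded one_absorbing_primary_submodule_def, THEN conjunct2] by simp
    then show ?thesis
    proof
      assume "?a \<otimes>\<^bsub>?R\<^esub> ?b \<in> colon ?R ?M ?N"
      then show ?thesis
        using assms(5,6) by (simp add: colon_Times_carrier RDirProd_simps)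
    next
      assume "?x \<in> module_rad ?R ?M ?N"
      then have "x \<in> module_rad R1 M1 N1"
        by (rule fst_in_module_rad[OF assms(5,6) x])
      then show ?thesis ..
    qed
  qed
  with assms(7) show ?thesis by (simp add: one_absorbing_primary_submodule_def)
qed

end
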